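(* Let $n\ge 1$, let $X,\overline{X},Y$ be path-connected topological spaces, and let $f=(f_1,\dots,f_n):X\to Y^n$ and $f'=(f'_1,\dots,f'_n):\overline{X}\to Y^n$ be surjective fibrations. If $f$ and $f'$ are fiber homotopy equivalent, then $TC_n(f)=TC_n(f')$.
   Context: For continuous maps $g_1,\dots,g_k:A\to B$, the higher homotopic distance $D(g_1,\dots,g_k)$ is the smallest positive integer $l$ such that $A$ has an open cover $U_1,\dots,U_l$ with $g_1|_{U_j}\simeq\cdots\simeq g_k|_{U_j}$ for every $j$; it is $\infty$ if there is no such cover. For a surjective fibration $f=(f_1,\dots,f_n):X\to Y^n$ with $n>1$, $TC_n(f)=D(f\circ p_1,\dots,f\circ p_n)$, where $p_i:X^n\to X$ is the projection onto the $i$-th factor; by convention $TC_1(f)=1$. Two maps $g:A\to B$ and $g':C\to B$ are fiber homotopy equivalent if there are continuous maps $u:A\to C$ and $v:C\to A$ with $g'\circ u=g$, $g\circ v=g'$, $u\circ v\simeq 1_C$ and $v\circ u\simeq 1_A$. *)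

theory Defs
  imports "HOL-Analysis.Analysis" "HOL-Library.Extended_Nat"
begin

definition homotopy_lifting ::
  "'z topology \<Rightarrow> 'a topology \<Rightarrow> 'b topology \<Rightarrow> ('a \<Rightarrow> 'b) \<Rightarrow> bool" where
  "homotopy_lifting Z E B p \<longleftrightarrow>
     (\<forall>H h. continuous_map (prod_topology (top_of_set {0..1::real}) Z) B H \<and>
            continuous_map Z E h \<and>
            (\<forall>z\<in>topspace Z. p (h z) = H (0, z)) \<longrightarrow>
        (\<exists>K. continuous_map (prod_topology (top_of_set {0..1::real}) Z) E K \<and>
             (\<forall>z\<in>topspace Z. K (0, z) = h z) \<and>
             (\<forall>t\<in>{0..1}. \<forall>z\<in>topspace Z. p (K (t, z)) = H (t, z))))"

text \<open>
  A (Hurewicz) fibration has the homotopy lifting property with respect to every space.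
  A definition in HOL cannot quantify over all types, so the test spaces range over all
  topologies on one sufficiently large type; \<open>fibration_homotopy_lifting\<close> below shows
  that the lifting property then holds for test spaces of arbitrary type.
\<close>
definition fibration :: "'a topology \<Rightarrow> 'b topology \<Rightarrow> ('a \<Rightarrow> 'b) \<Rightarrow> bool" where
  "fibration E B p \<longleftrightarrow>
     continuous_map E B p \<and>
     (\<forall>Z :: ('a \<times> (real \<Rightarrow> 'b)) topology. homotopy_lifting Z E B p)"

lemma quotient_map_onto_image_exists:
  obtains W where "quotient_map Z W q"
proof -
  define P where "P U \<longleftrightarrow> U \<subseteq> q ` topspace Z \<and> openin Z {z \<in> topspace Z. q z \<in> U}" for U
  have top: "istopology P"
    unfolding istopology_def
  proof (intro conjI allI impI)
    fix S T assume "P S" "P T"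
    moreover have "{z \<in> topspace Z. q z \<in> S \<inter> T} =
        {z \<in> topspace Z. q z \<in> S} \<inter> {z \<in> topspace Z. q z \<in> T}" by auto
    ultimately show "P (S \<inter> T)" unfolding P_def by auto
  next
    fix \<K> assume K: "\<forall>S\<in>\<K>. P S"
    have "{z \<in> topspace Z. q z \<in> \<Union>\<K>} = (\<Union>S\<in>\<K>. {z \<in> topspace Z. q z \<in> S})" by auto
    with K show "P (\<Union>\<K>)" unfolding P_def by auto
  qed
  define W where "W = topology P"
  have W: "openin W U \<longleftrightarrow> P U" for U
    using top by (simp add: W_def)
  have "{z \<in> topspace Z. q z \<in> q ` topspace Z} = topspace Z" by auto
  then have "P (q ` topspace Z)" by (simp add: P_def)
  then have "topspace W = q ` topspace Z"
    unfolding topspace_def [of W] W unfolding P_def by blast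
  then have "quotient_map Z W q"
    unfolding quotient_map_def W P_def by auto
  then show thesis by (rule that)
qed

lemma fibration_homotopy_lifting:
  fixes Z :: "'z topology" and E :: "'a topology" and B :: "'b topology"
  assumes "fibration E B p"
  shows "homotopy_lifting Z E B p"
  unfolding homotopy_lifting_def
proof (intro allI impI, elim conjE)
  let ?I = "top_of_set {0..1::real}"
  fix H h
  assume H: "continuous_map (prod_topology ?I Z) B H"
    and h: "continuous_map Z E h"
    and start: "\<forall>z\<in>topspace Z. p (h z) = H (0, z)"
  define q where "q z = (h z, \<lambda>t::real. if t \<in> {0..1} then H (t, z) else undefined)" for z
  obtain W where q: "quotient_map Z W q"
    by (rule quotient_map_onto_image_exists)
  have cq: "continuous_map Z W q" and W: "topspace W = q ` topspace Z"
    using q by (simp_all add: quotient_imp_continuous_map quotient_imp_surjective_map)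
  have "locally_compact_space ?I"
    by (intro compact_imp_locally_compact_space) (simp add: compact_space_subtopology)
  then have qI: "quotient_map (prod_topology ?I Z) (prod_topology ?I W) (\<lambda>(t, z). (t, q z))"
    by (intro quotient_map_prod_right q) (auto simp: Hausdorff_space_subtopology)
  define H' where "H' = (\<lambda>(t::real, w :: 'a \<times> (real \<Rightarrow> 'b)). snd w t)"
  have "continuous_map (prod_topology ?I Z) B (H' \<circ> (\<lambda>(t, z). (t, q z)))"
    by (rule continuous_map_eq [OF H]) (auto simp: H'_def q_def)
  then have H': "continuous_map (prod_topology ?I W) B H'"
    by (rule continuous_compose_quotient_map [OF qI])
  have "continuous_map Z E (fst \<circ> q)"
    by (rule continuous_map_eq [OF h]) (simp add: q_def)
  then have h': "continuous_map W E fst"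
    by (rule continuous_compose_quotient_map [OF q])
  have start': "\<forall>w\<in>topspace W. p (fst w) = H' (0, w)"
    using start by (auto simp: W q_def H'_def)
  obtain K where K: "continuous_map (prod_topology ?I W) E K"
      "\<forall>w\<in>topspace W. K (0, w) = fst w"
      "\<forall>t\<in>{0..1}. \<forall>w\<in>topspace W. p (K (t, w)) = H' (t, w)"
    using assms H' h' start' unfolding fibration_def homotopy_lifting_def by metis
  show "\<exists>K. continuous_map (prod_topology ?I Z) E K \<and>
             (\<forall>z\<in>topspace Z. K (0, z) = h z) \<and>
             (\<forall>t\<in>{0..1}. \<forall>z\<in>topspace Z. p (K (t, z)) = H (t, z))"
  proof (intro exI conjI)
    show "continuous_map (prod_topology ?I Z) E (K \<circ> (\<lambda>(t, z). (t, q z)))"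
      using K(1) qI by (blast intro: continuous_map_compose quotient_imp_continuous_map)
  qed (use K(2,3) in \<open>auto simp: W q_def H'_def\<close>)
qed

definition surjective_fibration :: "'a topology \<Rightarrow> 'b topology \<Rightarrow> ('a \<Rightarrow> 'b) \<Rightarrow> bool" where
  "surjective_fibration E B p \<longleftrightarrow> fibration E B p \<and> p ` topspace E = topspace B"

definition fiber_homotopy_equivalent ::
  "'a topology \<Rightarrow> 'c topology \<Rightarrow> 'b topology \<Rightarrow> ('a \<Rightarrow> 'b) \<Rightarrow> ('c \<Rightarrow> 'b) \<Rightarrow> bool" where
  "fiber_homotopy_equivalent A C B g g' \<longleftrightarrow>
     continuous_map A B g \<and> continuous_map C B g' \<and>
     (\<exists>u v. continuous_map A C u \<and> continuous_map C A v \<and>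
            (\<forall>a\<in>topspace A. g' (u a) = g a) \<and>
            (\<forall>c\<in>topspace C. g (v c) = g' c) \<and>
            homotopic_with (\<lambda>_. True) C C (u \<circ> v) id \<and>
            homotopic_with (\<lambda>_. True) A A (v \<circ> u) id)"

text \<open>The distance of the maps \<open>g 1, \<dots>, g k\<close>; the infimum of the empty set in \<open>enat\<close> is \<open>\<infinity>\<close>.\<close>
definition homotopic_distance ::
  "'a topology \<Rightarrow> 'b topology \<Rightarrow> nat \<Rightarrow> (nat \<Rightarrow> 'a \<Rightarrow> 'b) \<Rightarrow> enat" where
  "homotopic_distance A B k g =
     Inf {enat l | l. l \<ge> 1 \<and>
       (\<exists>U. (\<forall>j\<in>{1..l}. openin A (U j)) \<and>
            (\<Union>j\<in>{1..l}. U j) = topspace A \<and>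
            (\<forall>j\<in>{1..l}. \<forall>i\<in>{1..<k}.
               homotopic_with (\<lambda>_. True) (subtopology A (U j)) B (g i) (g (Suc i))))}"

abbreviation power_topology :: "'a topology \<Rightarrow> nat \<Rightarrow> (nat \<Rightarrow> 'a) topology" where
  "power_topology X n \<equiv> product_topology (\<lambda>_. X) {1..n}"

text \<open>For \<open>f : X \<rightarrow> Y\<^sup>n\<close>, the maps \<open>f \<circ> p\<^sub>i\<close> go from \<open>X\<^sup>n\<close> to \<open>Y\<^sup>n\<close>. Only \<open>n \<ge> 1\<close> is meaningful.\<close>
definition TC :: "nat \<Rightarrow> 'a topology \<Rightarrow> 'b topology \<Rightarrow> ('a \<Rightarrow> nat \<Rightarrow> 'b) \<Rightarrow> enat" where
  "TC n X Y f =
     (if n = 1 then 1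
      else homotopic_distance (power_topology X n) (power_topology Y n) n (\<lambda>i. f \<circ> (\<lambda>x. x i)))"

end

theory Submission
  imports Defs
begin

text \<open>
  If \<open>f' \<circ> u = f\<close>, then \<open>f \<circ> p\<^sub>i = (f' \<circ> p\<^sub>i) \<circ> u\<^sup>n\<close>, so pulling an admissible cover of \<open>X'\<^sup>n\<close> back along
  \<open>u\<^sup>n\<close> gives an admissible cover of \<open>X\<^sup>n\<close> of the same size. Maps over \<open>Y\<^sup>n\<close> in both directions
  therefore give both inequalities.
\<close>

lemma homotopic_distance_compose_le:
  assumes \<phi>: "continuous_map A A' \<phi>"
    and g: "\<And>i a. i \<in> {1..k} \<Longrightarrow> a \<in> topspace A \<Longrightarrow> g i a = g' i (\<phi> a)"
  shows "homotopic_distance A B k g \<le> homotopic_distance A' B k g'"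
  unfolding homotopic_distance_def
\<comment> \<open>Every cover size admissible for \<open>g'\<close> is shown to be admissible for
  \<open>g\<close>; the infimum over the larger set is the smaller one. If no size is admissible for
  \<open>g'\<close>, the bound is infinite and nothing has to be shown.\<close>
proof (rule Inf_superset_mono, clarify)
  fix l :: nat and U
  assume l: "1 \<le> l" and op: "\<forall>j\<in>{1..l}. openin A' (U j)"
    and cover: "(\<Union>j\<in>{1..l}. U j) = topspace A'"
    and hom: "\<forall>j\<in>{1..l}. \<forall>i\<in>{1..<k}.
      homotopic_with (\<lambda>_. True) (subtopology A' (U j)) B (g' i) (g' (Suc i))"
  define V where "V j = {a \<in> topspace A. \<phi> a \<in> U j}" for j
  have "openin A (V j)" if "j \<in> {1..l}" for j
    using \<phi> op that by (auto simp: V_def intro: openin_continuous_map_preimage)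
  moreover have "(\<Union>j\<in>{1..l}. V j) = topspace A"
    using continuous_map_image_subset_topspace [OF \<phi>] cover by (fastforce simp: V_def)
  moreover have "homotopic_with (\<lambda>_. True) (subtopology A (V j)) B (g i) (g (Suc i))"
    if "j \<in> {1..l}" "i \<in> {1..<k}" for i j
  proof -
    have "continuous_map (subtopology A (V j)) (subtopology A' (U j)) \<phi>"
      using \<phi> by (auto simp: V_def continuous_map_in_subtopology continuous_map_from_subtopology)
    then have "homotopic_with (\<lambda>_. True) (subtopology A (V j)) B (g' i \<circ> \<phi>) (g' (Suc i) \<circ> \<phi>)"
      using hom that by (blast intro: homotopic_with_compose_continuous_map_right)
    \<comment> \<open>\<open>g i\<close> and \<open>g' i \<circ> \<phi>\<close> need agree only on
      \<open>topspace A\<close>. As \<open>i < k\<close>, both \<open>i\<close> and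
      \<open>Suc i\<close> lie in \<open>{1..k}\<close>, where \<open>g\<close> factors through
      \<open>\<phi>\<close>.\<close>
    then show ?thesis
      by (rule homotopic_with_eq) (use that g in auto)
  qed
  ultimately show "\<exists>l'. enat l = enat l' \<and> 1 \<le> l' \<and>
      (\<exists>U. (\<forall>j\<in>{1..l'}. openin A (U j)) \<and> (\<Union>j\<in>{1..l'}. U j) = topspace A \<and>
        (\<forall>j\<in>{1..l'}. \<forall>i\<in>{1..<k}.
          homotopic_with (\<lambda>_. True) (subtopology A (U j)) B (g i) (g (Suc i))))"
    using l by blast
qed

text \<open>This is \<open>u\<close> applied in each factor. Points of a product topology are
  extensional functions, hence the restriction to \<open>{1..n}\<close>.\<close>

lemma continuous_map_power:
  assumes "continuous_map X X' u"
  shows "continuous_map (power_topology X n) (power_topology X' n) (\<lambda>x. \<lambda>i\<in>{1..n}. u (x i))"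
proof -
  have "continuous_map (power_topology X n) X' (\<lambda>x. u (x i))" if "i \<in> {1..n}" for i
    using continuous_map_compose [of "power_topology X n" X "\<lambda>x. x i" X' u]
      continuous_map_product_projection [OF that, of "\<lambda>_. X"] assms
    by (simp add: o_def)
  then show ?thesis
    by (auto simp: continuous_map_componentwise)
qed

lemma TC_le:
  assumes u: "continuous_map X X' u" and fu: "\<And>x. x \<in> topspace X \<Longrightarrow> f' (u x) = f x"
  shows "TC n X Y f \<le> TC n X' Y f'"
proof (cases "n = 1")
  case False
  have "homotopic_distance (power_topology X n) (power_topology Y n) n (\<lambda>i. f \<circ> (\<lambda>x. x i))
      \<le> homotopic_distance (power_topology X' n) (power_topology Y n) n (\<lambda>i. f' \<circ> (\<lambda>x. x i))"
    \<comment> \<open>For \<open>i\<close> in \<open>{1..n}\<close> the \<open>i\<close>-th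
      coordinate of the image of \<open>x\<close> is \<open>u (x i)\<close>, and \<open>x i\<close>
      is a point of \<open>X\<close>, so \<open>fu\<close> applies.\<close>
    by (rule homotopic_distance_compose_le [OF continuous_map_power [OF u]])
      (auto simp: fu topspace_product_topology PiE_iff)
  with False show ?thesis by (simp add: TC_def)
qed (simp add: TC_def)

theorem corollary3p14:
  fixes n :: nat
    and X :: "'a topology" and X' :: "'c topology" and Y :: "'b topology"
    and f :: "'a \<Rightarrow> nat \<Rightarrow> 'b" and f' :: "'c \<Rightarrow> nat \<Rightarrow> 'b"
  assumes "n \<ge> 1"
    and "path_connected_space X" and "path_connected_space X'" and "path_connected_space Y"
    and "surjective_fibration X (power_topology Y n) f"
    and "surjective_fibration X' (power_topology Y n) f'"
    and "fiber_homotopy_equivalent X X' (power_topology Y n) f f'"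
  shows "TC n X Y f = TC n X' Y f'"
proof -
  obtain u v where "continuous_map X X' u" "continuous_map X' X v"
    "\<And>x. x \<in> topspace X \<Longrightarrow> f' (u x) = f x" "\<And>x'. x' \<in> topspace X' \<Longrightarrow> f (v x') = f' x'"
    using assms(7) unfolding fiber_homotopy_equivalent_def by auto
  then show ?thesis
    \<comment> \<open>One inequality comes from \<open>u\<close>, the reverse one from
      \<open>v\<close>.\<close>
    by (intro antisym TC_le)
qed

end
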